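(* Let $B_n=\sum_{k=1}^n \frac{2}{n(n+1)^2}\binom{n+1}{k-1}\binom{n+1}{k}\binom{n+1}{k+1}$ for $n\ge 1$ (the Baxter numbers). Then the sequence $\{B_n\}_{n\ge 1}$ is asymptotically $r$-log-convex for every integer $r\ge 1$. Moreover, $\{B_n\}_{n\ge 1}$ is $2$-log-convex.
   Context: For a real sequence $\{a_n\}$, define the operator $\mathscr{L}(\{a_n\})=\{a_na_{n+2}-a_{n+1}^2\}$ (indexed from the same starting index), and let $\mathscr{L}^j$ denote its $j$-th iterate. The sequence is $r$-log-convex if $\mathscr{L}^j(\{a_n\})$ is a nonnegative sequence for every $1\le j\le r$. It is asymptotically $r$-log-convex if, for each $1\le j\le r$, all terms of $\mathscr{L}^j(\{a_n\})$ are nonnegative except possibly finitely many initial terms. *)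

theory Defs
  imports Complex_Main
begin

text \<open>
  A sequence \<open>a\<^sub>s, a\<^sub>s\<^sub>+\<^sub>1, \<dots>\<close> with starting index \<open>s\<close> is represented by a function on all of
  \<open>nat\<close> whose values below \<open>s\<close> are irrelevant: the \<open>n\<close>-th term of any iterate of the operator
  below only depends on terms with index at least \<open>n\<close>.
\<close>

definition log_op :: "(nat \<Rightarrow> real) \<Rightarrow> nat \<Rightarrow> real" where
  "log_op a = (\<lambda>n. a n * a (n + 2) - (a (n + 1))\<^sup>2)"

definition r_log_convex_from :: "nat \<Rightarrow> nat \<Rightarrow> (nat \<Rightarrow> real) \<Rightarrow> bool" where
  "r_log_convex_from s r a \<longleftrightarrow>
     (\<forall>j. 1 \<le> j \<and> j \<le> r \<longrightarrow> (\<forall>n\<ge>s. (log_op ^^ j) a n \<ge> 0))"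

text \<open>The number of exceptional initial terms may depend on \<open>j\<close>; the starting index plays no role.\<close>

definition asymptotically_r_log_convex :: "nat \<Rightarrow> (nat \<Rightarrow> real) \<Rightarrow> bool" where
  "asymptotically_r_log_convex r a \<longleftrightarrow>
     (\<forall>j. 1 \<le> j \<and> j \<le> r \<longrightarrow> (\<forall>\<^sub>F n in sequentially. (log_op ^^ j) a n \<ge> 0))"

text \<open>Only the values for \<open>n \<ge> 1\<close> are meaningful (at \<open>n = 0\<close> the sum is empty).\<close>

definition baxter :: "nat \<Rightarrow> real" where
  "baxter n = (\<Sum>k=1..n. 2 / (real n * (real n + 1)\<^sup>2)
     * real ((n + 1) choose (k - 1)) * real ((n + 1) choose k) * real ((n + 1) choose (k + 1)))"

end

theory Submission
  imports Defs "HOL-Analysis.Analysis"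
begin

text \<open>
  If \<open>a\<close> is the moment sequence of a positive measure \<open>\<mu>\<close> on \<open>[-m, M]\<close>, then \<open>log_op a\<close> is the moment
  sequence of the image of \<open>(x - y)\<^sup>2 / 2 \<cdot> \<mu> \<otimes> \<mu>\<close> under \<open>(x, y) \<mapsto> x * y\<close>, a measure on \<open>[-m M, M\<^sup>2]\<close>.
  If \<open>m < M\<close> and \<open>\<mu>\<close> charges every left neighbourhood of \<open>M\<close>, both properties persist, and the
  moments are eventually positive because the mass near the top of the support dominates.

  The shifted Baxter numbers are such moments, with \<open>m = 1\<close> and \<open>M = 8\<close>: the product of binomial
  coefficients in \<^const>\<open>baxter\<close> is a determinant of binomial coefficients, so by Weyl integration
  \<open>baxter (n + 1)\<close> is the integral of \<open>det (1 + g) ^ n\<close> over the Haar measure of \<open>SU(3)\<close>.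

  For the exact statement, even moments are nonnegative, and integrating
  \<open>x ^ n * (x - l)\<^sup>2 * (x + l) \<ge> 0\<close> for even \<open>n\<close> and \<open>l \<ge> m\<close> propagates \<open>a (n + 1) \<ge> l * a n\<close> from one
  even index to the next; it holds at a small index for the first two iterates of \<^const>\<open>log_op\<close>.
\<close>

subsection \<open>Moment sequences\<close>

text \<open>
  The mass condition on the open intervals ending in \<open>M\<close> rules out that \<open>\<mu>\<close> is carried near \<open>M\<close>
  by a single atom, where the weight \<open>(x - y)\<^sup>2\<close> of the operator \<^const>\<open>log_op\<close> would vanish.
\<close>

definition moment_sequence :: "real \<Rightarrow> real \<Rightarrow> (nat \<Rightarrow> real) \<Rightarrow> bool" where
  "moment_sequence m M a \<longleftrightarrow> (\<exists>\<mu>. finite_measure \<mu> \<and> sets \<mu> = sets borel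
     \<and> (AE x in \<mu>. - m \<le> x \<and> x \<le> M) \<and> (\<forall>t<M. emeasure \<mu> {t<..<M} > 0)
     \<and> (\<forall>n. a n = (\<integral>x. x ^ n \<partial>\<mu>)))"

text \<open>The representing measure is the image under \<open>f\<close> of \<open>P\<close> with
  density \<open>w\<close>. The bound \<open>C\<close> keeps it finite, and each set
  \<open>A\<close> yields mass in \<open>{t<..<M}\<close> because \<open>w\<close> is positive
  there. It serves twice: with \<open>P\<close> a product measure for \<open>log_op\<close>, and
  with \<open>P\<close> the torus for the Baxter numbers.\<close>

lemma moment_sequence_pushforward:
  fixes P :: "'a measure" and f w :: "'a \<Rightarrow> real"
  assumes "finite_measure P"
    and [measurable]: "f \<in> borel_measurable P" "w \<in> borel_measurable P"
    and f: "AE x in P. - m \<le> f x \<and> f x \<le> M"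
    and w: "\<And>x. 0 \<le> w x" "AE x in P. w x \<le> C"
    and top: "\<And>t. t < M \<Longrightarrow> \<exists>A\<in>sets P. emeasure P A > 0 \<and> (\<forall>x\<in>A. t < f x \<and> f x < M \<and> 0 < w x)"
    and a: "\<And>n. a n = (\<integral>x. f x ^ n * w x \<partial>P)"
  shows "moment_sequence m M a"
proof -
  interpret finite_measure P by fact
  define D where "D = density P (\<lambda>x. ennreal (w x))"
  define \<mu> where "\<mu> = distr D borel f"
  have fD [measurable]: "f \<in> borel_measurable D"
    by (simp add: D_def)
  have "emeasure D (space D) < \<infinity>"
  proof -
    have "emeasure D (space D) = (\<integral>\<^sup>+x. ennreal (w x) \<partial>P)"
      by (simp add: D_def emeasure_density cong: nn_integral_cong)
    also have "\<dots> \<le> (\<integral>\<^sup>+x. ennreal C \<partial>P)"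
      by (rule nn_integral_mono_AE) (use w(2) in \<open>auto intro: ennreal_leI\<close>)
    also have "\<dots> < \<infinity>"
      by (simp add: ennreal_mult_eq_top_iff less_top[symmetric])
    finally show ?thesis .
  qed
  then interpret D: finite_measure D
    by (intro finite_measureI) simp
  have "finite_measure \<mu>"
    unfolding \<mu>_def by (rule D.finite_measure_distr) simp
  moreover have "sets \<mu> = sets borel"
    by (simp add: \<mu>_def)
  moreover have "AE x in \<mu>. - m \<le> x \<and> x \<le> M"
  proof -
    have "AE x in D. - m \<le> f x \<and> f x \<le> M"
      unfolding D_def by (subst AE_density) (use f in auto)
    then show ?thesis
      unfolding \<mu>_def by (subst AE_distr_iff) auto
  qed
  moreover have "emeasure \<mu> {t<..<M} > 0" if "t < M" for t
  proof (rule ccontr)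
    assume "\<not> ?thesis"
    then have "emeasure D (f -` {t<..<M} \<inter> space P) = 0"
      by (simp add: \<mu>_def emeasure_distr D_def)
    then have "(\<integral>\<^sup>+x. ennreal (w x) * indicator (f -` {t<..<M} \<inter> space P) x \<partial>P) = 0"
      unfolding D_def by (subst (asm) emeasure_density) auto
    then have ae: "AE x in P. ennreal (w x) * indicator (f -` {t<..<M} \<inter> space P) x = 0"
      by (subst (asm) nn_integral_0_iff_AE) auto
    from top[OF that] obtain A where A: "A \<in> sets P" "emeasure P A > 0"
      "\<And>x. x \<in> A \<Longrightarrow> t < f x \<and> f x < M \<and> 0 < w x" by blast
    from ae have "AE x in P. x \<notin> A"
      by (rule AE_mp) (intro AE_I2 impI, use A(3) in \<open>force simp: indicator_def\<close>)
    then have "emeasure P A = 0"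
      using A(1) by (subst (asm) AE_iff_measurable[of A]) (auto dest: sets.sets_into_space)
    with A(2) show False by simp
  qed
  moreover have "a n = (\<integral>x. x ^ n \<partial>\<mu>)" for n
  proof -
    have "(\<integral>x. x ^ n \<partial>\<mu>) = (\<integral>x. f x ^ n \<partial>D)"
      unfolding \<mu>_def by (rule integral_distr) auto
    also have "\<dots> = (\<integral>x. w x * f x ^ n \<partial>P)"
      unfolding D_def by (subst integral_density) (use w in auto)
    finally show ?thesis
      by (simp add: a mult.commute)
  qed
  ultimately show ?thesis
    unfolding moment_sequence_def by blast
qed

lemma integrable_power_AE_bounded:
  assumes "finite_measure \<mu>" "sets \<mu> = sets borel" "AE x in \<mu>. - m \<le> x \<and> x \<le> M"
  shows "integrable \<mu> (\<lambda>x. x ^ n :: real)"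
proof -
  interpret finite_measure \<mu> by fact
  note assms(2)[measurable_cong]
  show ?thesis
  proof (rule integrable_const_bound)
    show "AE x in \<mu>. norm (x ^ n) \<le> (max \<bar>m\<bar> \<bar>M\<bar>) ^ n"
      using assms(3)
      by eventually_elim (simp only: real_norm_def power_abs, rule power_mono, auto)
  qed simp
qed

text \<open>Under the product measure \<open>x ^ i * y ^ j\<close> integrates to
  \<open>a i * a j\<close>. The two square terms of the weight \<open>(x - y)\<^sup>2 / 2\<close>
  thus give \<open>a n * a (n + 2)\<close> together, and the cross term gives the subtracted square.
  A negative product has factors of opposite sign, whence the lower end
  \<open>- (m * M)\<close>.\<close>

lemma moment_sequence_log_op:
  assumes a: "moment_sequence m M a" and mM: "0 \<le> m" "m < M"
  shows "moment_sequence (m * M) (M\<^sup>2) (log_op a)"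
proof -
  from a obtain \<mu> where "finite_measure \<mu>" and S [measurable_cong]: "sets \<mu> = sets borel"
    and bd: "AE x in \<mu>. - m \<le> x \<and> x \<le> M" and top: "\<And>t. t < M \<Longrightarrow> emeasure \<mu> {t<..<M} > 0"
    and am: "\<And>n. a n = (\<integral>x. x ^ n \<partial>\<mu>)"
    unfolding moment_sequence_def by blast
  interpret finite_measure \<mu> by fact
  interpret P: pair_sigma_finite \<mu> \<mu> ..
  define f where "f = (\<lambda>(x, y). x * y :: real)"
  define w where "w = (\<lambda>(x, y). (x - y)\<^sup>2 / 2 :: real)"
  have [measurable]: "f \<in> borel_measurable (\<mu> \<Otimes>\<^sub>M \<mu>)" "w \<in> borel_measurable (\<mu> \<Otimes>\<^sub>M \<mu>)"
    by (simp_all add: f_def w_def)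
  have ae: "AE p in \<mu> \<Otimes>\<^sub>M \<mu>. (- m \<le> fst p \<and> fst p \<le> M) \<and> (- m \<le> snd p \<and> snd p \<le> M)"
    by (rule P.AE_pair_measure) (use bd in auto)
  note int = integrable_power_AE_bounded[OF \<open>finite_measure \<mu>\<close> S bd]
  show ?thesis
  proof (rule moment_sequence_pushforward[where P = "\<mu> \<Otimes>\<^sub>M \<mu>" and f = f and w = w and C = "2 * M\<^sup>2"])
    show "finite_measure (\<mu> \<Otimes>\<^sub>M \<mu>)"
      by (intro finite_measureI)
         (simp add: space_pair_measure emeasure_pair_measure_Times ennreal_mult_eq_top_iff)
    show "AE p in \<mu> \<Otimes>\<^sub>M \<mu>. - (m * M) \<le> f p \<and> f p \<le> M\<^sup>2"
      using ae
    proof eventually_elim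
      case (elim p)
      obtain x y where p: "p = (x, y)" by force
      have xy: "- m \<le> x" "x \<le> M" "- m \<le> y" "y \<le> M" using elim by (auto simp: p)
      have "\<bar>x\<bar> \<le> M" "\<bar>y\<bar> \<le> M" using xy mM by auto
      then have "\<bar>x * y\<bar> \<le> M * M" unfolding abs_mult by (intro mult_mono) auto
      then have "x * y \<le> M\<^sup>2" by (simp add: power2_eq_square)
      moreover have "- (m * M) \<le> x * y"
      proof (cases "0 \<le> x"; cases "0 \<le> y")
        assume h: "0 \<le> x" "\<not> 0 \<le> y"
        have "x * (- y) \<le> M * m" by (intro mult_mono) (use h xy mM in auto)
        then show ?thesis by (simp add: mult.commute)
      next
        assume h: "\<not> 0 \<le> x" "0 \<le> y"
        have "(- x) * y \<le> m * M" by (intro mult_mono) (use h xy mM in auto)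
        then show ?thesis by simp
      next
        assume "0 \<le> x" "0 \<le> y"
        then show ?thesis using mM
          by (smt (verit) mult_nonneg_nonneg)
      next
        assume "\<not> 0 \<le> x" "\<not> 0 \<le> y"
        then show ?thesis using mM
          by (smt (verit) mult_nonneg_nonneg mult_neg_neg)
      qed
      ultimately show ?case by (simp add: f_def p)
    qed
    show "0 \<le> w p" for p
      by (simp add: w_def split: prod.split)
    show "AE p in \<mu> \<Otimes>\<^sub>M \<mu>. w p \<le> 2 * M\<^sup>2"
      using ae
    proof eventually_elim
      case (elim p)
      obtain x y where p: "p = (x, y)" by force
      have "\<bar>x - y\<bar> \<le> 2 * M" using elim mM by (auto simp: p)
      then have "\<bar>x - y\<bar>\<^sup>2 \<le> (2 * M)\<^sup>2" by (intro power_mono) auto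
      then show ?case by (simp add: w_def p power_mult_distrib)
    qed
    show "\<exists>A\<in>sets (\<mu> \<Otimes>\<^sub>M \<mu>). emeasure (\<mu> \<Otimes>\<^sub>M \<mu>) A > 0
            \<and> (\<forall>p\<in>A. t < f p \<and> f p < M\<^sup>2 \<and> 0 < w p)" if t: "t < M\<^sup>2" for t
    proof -
      \<comment> \<open>Two factors above \<open>s\<close> have a product above
        \<open>s\<^sup>2\<close>, hence above \<open>t\<close>; the \<open>max\<close> covers
        negative \<open>t\<close>.\<close>
      define s where "s = sqrt (max t 0)"
      have s: "0 \<le> s" "t \<le> s\<^sup>2" "s < M"
        using t mM by (auto simp: s_def intro!: real_less_lsqrt)
      \<comment> \<open>Splitting \<open>{s<..<M}\<close> at a point \<open>u\<close> with mass on
        both sides gives a rectangle that avoids the diagonal, where \<open>w\<close> vanishes. If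
        no \<open>u\<close> worked, \<open>{s<..<M}\<close> would be covered by countably many null
        sets.\<close>
      have "\<exists>u. s < u \<and> u < M \<and> emeasure \<mu> {s<..u} > 0"
      proof (rule ccontr)
        assume none: "\<not> ?thesis"
        define u where "u = (\<lambda>n::nat. M - (M - s) / real (n + 2))"
        have u: "s < u n \<and> u n < M" for n
        proof -
          have "(M - s) / real (n + 2) < (M - s) / 1"
            using s by (intro divide_strict_left_mono) auto
          then show ?thesis using s by (simp add: u_def)
        qed
        have "{s<..<M} \<subseteq> (\<Union>n. {s<..u n})"
        proof
          fix x assume x: "x \<in> {s<..<M}"
          obtain n where n: "(M - s) / (M - x) < real n" using reals_Archimedean2 by blast
          then have "M - s < real (n + 2) * (M - x)"
            using x by (simp add: field_simps)
          then have "(M - s) / real (n + 2) < M - x"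
            by (simp add: field_simps)
          then have "x \<le> u n" by (simp add: u_def)
          then show "x \<in> (\<Union>n. {s<..u n})" using x by auto
        qed
        then have "emeasure \<mu> {s<..<M} \<le> emeasure \<mu> (\<Union>n. {s<..u n})"
          by (intro emeasure_mono) (auto simp: S)
        also have "\<dots> = 0"
          by (rule emeasure_UN_eq_0) (use none u in \<open>auto simp: S\<close>)
        finally show False using top[OF s(3)] by simp
      qed
      then obtain u where u: "s < u" "u < M" "emeasure \<mu> {s<..u} > 0" by blast
      show ?thesis
      proof (intro bexI[of _ "{s<..u} \<times> {u<..<M}"] conjI ballI)
        show "{s<..u} \<times> {u<..<M} \<in> sets (\<mu> \<Otimes>\<^sub>M \<mu>)" by (simp add: S)
        show "emeasure (\<mu> \<Otimes>\<^sub>M \<mu>) ({s<..u} \<times> {u<..<M}) > 0"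
          using u top[OF u(2)] by (simp add: emeasure_pair_measure_Times S ennreal_zero_less_mult_iff)
      next
        fix p assume "p \<in> {s<..u} \<times> {u<..<M}"
        then obtain x y where p: "p = (x, y)" "s < x" "x \<le> u" "u < y" "y < M" by force
        have "s * s < x * y" by (rule mult_strict_mono') (use p s in auto)
        then show "t < f p" using s(2) by (simp add: f_def p power2_eq_square)
        have "x * y < M * M" by (rule mult_strict_mono') (use p s u in auto)
        then show "f p < M\<^sup>2" by (simp add: f_def p power2_eq_square)
        show "0 < w p" using p by (simp add: w_def)
      qed
    qed
    show "log_op a n = (\<integral>p. f p ^ n * w p \<partial>(\<mu> \<Otimes>\<^sub>M \<mu>))" for n
    proof -
      have "integrable (\<mu> \<Otimes>\<^sub>M \<mu>) (\<lambda>(x, y). x ^ i * y ^ j)"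
        and "(\<integral>p. (case p of (x, y) \<Rightarrow> x ^ i * y ^ j) \<partial>(\<mu> \<Otimes>\<^sub>M \<mu>)) = a i * a j" for i j
      proof -
        show I: "integrable (\<mu> \<Otimes>\<^sub>M \<mu>) (\<lambda>(x, y). x ^ i * y ^ j)"
          by (rule P.Fubini_integrable) (use int in \<open>auto simp: abs_mult\<close>)
        show "(\<integral>p. (case p of (x, y) \<Rightarrow> x ^ i * y ^ j) \<partial>(\<mu> \<Otimes>\<^sub>M \<mu>)) = a i * a j"
          by (subst P.integral_fst'[OF I, symmetric]) (simp add: am)
      qed
      note * = this
      have "(\<lambda>p. f p ^ n * w p) = (\<lambda>p. ((case p of (x, y) \<Rightarrow> x ^ (n + 2) * y ^ n)
          + (case p of (x, y) \<Rightarrow> x ^ n * y ^ (n + 2))) / 2 - (case p of (x, y) \<Rightarrow> x ^ (n + 1) * y ^ (n + 1)))"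
        by (auto simp: fun_eq_iff f_def w_def power_mult_distrib power2_diff power_add algebra_simps
              power2_eq_square add_divide_distrib diff_divide_distrib)
      then show ?thesis
        by (simp add: *[simplified] log_op_def power2_eq_square del: power_Suc split_beta)
    qed
  qed simp_all
qed

section \<open>Nonnegativity of moments, from a given index and eventually\<close>

lemma moment_sequence_even_nonneg:
  assumes "moment_sequence m M a" "even n"
  shows "0 \<le> a n"
  using assms by (auto simp: moment_sequence_def intro!: integral_nonneg_AE zero_le_even_power)

text \<open>In \<open>x ^ n * (x - l)\<^sup>2 * (x + l)\<close> only the last factor could change
  sign, and \<open>- l \<le> - m \<le> x\<close> on the support. The expanded integral is arranged
  so that the same difference appears at \<open>n\<close> and at \<open>n + 2\<close>.\<close>

lemma moment_sequence_cubic_ineq: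
  assumes "moment_sequence m M a" "m \<le> l" "even n"
  shows "l\<^sup>2 * (a (n + 1) - l * a n) \<le> a (n + 3) - l * a (n + 2)"
proof -
  from assms(1) obtain \<mu> where mu: "finite_measure \<mu>" "sets \<mu> = sets borel"
    "AE x in \<mu>. - m \<le> x \<and> x \<le> M" and am: "\<And>n. a n = (\<integral>x. x ^ n \<partial>\<mu>)"
    unfolding moment_sequence_def by blast
  note I = integrable_power_AE_bounded[OF mu]
  have "0 \<le> (\<integral>x. x ^ n * ((x - l)\<^sup>2 * (x + l)) \<partial>\<mu>)"
    by (rule integral_nonneg_AE, use mu(3) in eventually_elim)
       (use assms in \<open>auto intro!: mult_nonneg_nonneg zero_le_even_power\<close>)
  also have "(\<lambda>x. x ^ n * ((x - l)\<^sup>2 * (x + l)))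
      = (\<lambda>x. x ^ (n + 3) - l * x ^ (n + 2) - (l\<^sup>2 * x ^ (n + 1) - l ^ 3 * x ^ n))"
    by (auto simp: fun_eq_iff power_add algebra_simps power2_eq_square power3_eq_cube)
  also have "(\<integral>x. (x ^ (n + 3) - l * x ^ (n + 2) - (l\<^sup>2 * x ^ (n + 1) - l ^ 3 * x ^ n)) \<partial>\<mu>)
     = a (n + 3) - l * a (n + 2) - (l\<^sup>2 * a (n + 1) - l ^ 3 * a n)"
    using I by (simp add: am del: power_Suc)
  finally show ?thesis by (simp add: algebra_simps power2_eq_square power3_eq_cube)
qed

text \<open>At an odd index the propagated inequality bounds the term below by \<open>l\<close>
  times its even predecessor, which is nonnegative.\<close>

lemma moment_sequence_nonneg_from:
  assumes a: "moment_sequence m M a" and l: "m \<le> l" "0 \<le> l"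
    and k: "even k" "l * a k \<le> a (k + 1)" and n: "k \<le> n"
  shows "0 \<le> a n"
proof (cases "even n")
  case True
  with a show ?thesis by (rule moment_sequence_even_nonneg)
next
  case False
  have *: "l * a (k + 2 * i) \<le> a (k + 2 * i + 1)" for i
  proof (induction i)
    case (Suc i)
    have "0 \<le> l\<^sup>2 * (a (k + 2 * i + 1) - l * a (k + 2 * i))" using Suc by simp
    also have "\<dots> \<le> a (k + 2 * i + 3) - l * a (k + 2 * i + 2)"
      using moment_sequence_cubic_ineq[OF a l(1), of "k + 2 * i"] k(1) by simp
    finally show ?case by (simp add: eval_nat_numeral)
  qed (use k in simp)
  obtain i where i: "n = k + 2 * i + 1"
  proof -
    have "odd (n - k)" using False k(1) n by auto
    then obtain i where "n - k = 2 * i + 1" by (rule oddE)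
    then show thesis using that[of i] n by simp
  qed
  have "0 \<le> l * a (k + 2 * i)"
    using moment_sequence_even_nonneg[OF a] k(1) l by simp
  with *[of i] show ?thesis by (simp add: i)
qed

text \<open>On the support \<open>x ^ n\<close> is at least \<open>t ^ n\<close> on
  \<open>{t<..<M}\<close> and at least \<open>- m ^ n\<close> elsewhere. The interval has positive
  mass and \<open>m < t\<close>, so the first contribution wins exponentially.\<close>

lemma moment_sequence_eventually_nonneg:
  assumes a: "moment_sequence m M a" and mM: "0 \<le> m" "m < M"
  shows "\<forall>\<^sub>F n in sequentially. 0 \<le> a n"
proof -
  from a obtain \<mu> where mu: "finite_measure \<mu>" and S [measurable_cong]: "sets \<mu> = sets borel"
    and bd: "AE x in \<mu>. - m \<le> x \<and> x \<le> M" and top: "\<And>t. t < M \<Longrightarrow> emeasure \<mu> {t<..<M} > 0"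
    and am: "\<And>n. a n = (\<integral>x. x ^ n \<partial>\<mu>)"
    unfolding moment_sequence_def by blast
  interpret finite_measure \<mu> by fact
  note I = integrable_power_AE_bounded[OF mu S bd]
  define t where "t = (m + M) / 2"
  have t: "m < t" "t < M" using mM by (auto simp: t_def)
  define c where "c = measure \<mu> {t<..<M}"
  define K where "K = measure \<mu> (space \<mu>)"
  have c: "c > 0" using top[OF t(2)] by (simp add: c_def emeasure_eq_measure)
  have K: "0 \<le> K" by (simp add: K_def)
  have low: "c * t ^ n - K * m ^ n \<le> a n" for n
  proof -
    have "c * t ^ n - K * m ^ n = (\<integral>x. t ^ n * indicator {t<..<M} x - m ^ n \<partial>\<mu>)"
      by (subst Bochner_Integration.integral_diff)
         (simp_all add: c_def K_def mult.commute S emeasure_eq_measure)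
    also have "\<dots> \<le> (\<integral>x. x ^ n \<partial>\<mu>)"
    proof (rule integral_mono_AE)
      show "AE x in \<mu>. t ^ n * indicator {t<..<M} x - m ^ n \<le> x ^ n"
        using bd
      proof eventually_elim
        case (elim x)
        consider "x \<in> {t<..<M}" | "x \<notin> {t<..<M}" "0 \<le> x" | "x < 0" "x \<notin> {t<..<M}" by linarith
        then show ?case
        proof cases
          case 1
          then have "t ^ n \<le> x ^ n" using t mM by (intro power_mono) auto
          moreover have "0 \<le> m ^ n" using mM by simp
          ultimately show ?thesis using 1 by simp
        next
          case 2
          then have "0 \<le> x ^ n" "0 \<le> m ^ n" using mM by auto
          then show ?thesis by (simp only: indicator_simps(2)[OF 2(1)] mult_zero_right)
        next
          case 3
          then have "\<bar>x ^ n\<bar> \<le> m ^ n" unfolding power_abs using elim by (intro power_mono) auto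
          then show ?thesis by (simp only: indicator_simps(2)[OF 3(2)])
        qed
      qed
    qed (use I S in \<open>auto simp: emeasure_eq_measure intro!: integrable_real_indicator\<close>)
    finally show ?thesis by (simp add: am)
  qed
  have "(\<lambda>n. K * (m / t) ^ n) \<longlonglongrightarrow> K * 0"
    using t mM by (intro tendsto_mult tendsto_const LIMSEQ_power_zero) auto
  then have "\<forall>\<^sub>F n in sequentially. K * (m / t) ^ n < c"
    using c by (auto dest: order_tendstoD(2))
  then show ?thesis
  proof eventually_elim
    case (elim n)
    have "K * m ^ n \<le> c * t ^ n"
      using elim t mM by (simp add: power_divide field_simps)
    with low[of n] show ?case by simp
  qed
qed

text \<open>The strict gap is an invariant: \<open>m < M\<close> gives \<open>m * M < M * M\<close>,
  as \<open>M\<close> is positive.\<close>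

lemma moment_sequence_log_op_funpow:
  assumes "moment_sequence m M a" and "0 \<le> m" "m < M"
  shows "\<exists>m' M'. 0 \<le> m' \<and> m' < M' \<and> moment_sequence m' M' ((log_op ^^ j) a)"
proof (induction j)
  case 0
  then show ?case using assms by auto
next
  case (Suc j)
  then obtain m' M' where "0 \<le> m'" "m' < M'" "moment_sequence m' M' ((log_op ^^ j) a)" by blast
  then show ?case
    using moment_sequence_log_op
    by (intro exI[of _ "m' * M'"] exI[of _ "M'\<^sup>2"]) (auto simp: power2_eq_square)
qed

subsection \<open>Fourier integrals on the torus\<close>

lemma cis_measurable [measurable]: "cis \<in> borel_measurable borel"
  by (intro borel_measurable_continuous_onI continuous_intros)

text \<open>Normalised Haar measure of the circle in the angle coordinate, carried on all of
  \<open>real\<close>.\<close>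

definition circle_measure :: "real measure" where
  "circle_measure = density lborel (\<lambda>x. ennreal (indicator {0..2 * pi} x / (2 * pi)))"

lemma sets_circle_measure [simp, measurable_cong]: "sets circle_measure = sets borel"
  by (simp add: circle_measure_def)

lemma space_circle_measure [simp]: "space circle_measure = UNIV"
  by (simp add: circle_measure_def)

lemma finite_measure_circle_measure: "finite_measure circle_measure"
proof (rule finite_measureI)
  have "emeasure circle_measure (space circle_measure)
      = (\<integral>\<^sup>+x. ennreal (1 / (2 * pi)) * indicator {0..2 * pi} x \<partial>lborel)"
    by (simp add: circle_measure_def emeasure_density)
       (intro nn_integral_cong, auto simp: indicator_def)
  also have "\<dots> < \<infinity>"
    by (subst nn_integral_cmult_indicator) (simp_all add: ennreal_mult_less_top)
  finally show "emeasure circle_measure (space circle_measure) \<noteq> \<infinity>" by simp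
qed

lemma emeasure_circle_measure_pos:
  assumes "0 \<le> a" "a < b" "b \<le> 2 * pi"
  shows "emeasure circle_measure {a<..<b} > 0"
proof -
  have "emeasure circle_measure {a<..<b}
      = (\<integral>\<^sup>+x. ennreal (1 / (2 * pi)) * indicator {a<..<b} x \<partial>lborel)"
    unfolding circle_measure_def
    by (subst emeasure_density) (use assms in \<open>auto intro!: nn_integral_cong simp: indicator_def\<close>)
  also have "\<dots> > 0"
    using assms by (subst nn_integral_cmult_indicator) (simp_all add: ennreal_zero_less_mult_iff)
  finally show ?thesis .
qed

text \<open>Orthogonality of the characters of the circle: a nonconstant one has a periodic
  antiderivative.\<close>

lemma integral_cis_circle_measure:
  "(\<integral>x. cis (of_int p * x) \<partial>circle_measure) = (if p = 0 then 1 else 0)"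
proof -
  have *: "(\<integral>x. cis (of_int p * x) \<partial>circle_measure)
      = (\<integral>x. indicator {0..2 * pi} x *\<^sub>R (cis (of_int p * x) / (2 * pi)) \<partial>lborel)"
    unfolding circle_measure_def
    by (subst integral_density) (auto intro!: Bochner_Integration.integral_cong simp: indicator_def scaleR_conv_of_real)
  show ?thesis
  proof (cases "p = 0")
    case True
    then show ?thesis unfolding * by (simp add: scaleR_conv_of_real)
  next
    case False
    define G where "G = (\<lambda>x. - \<i> * cis (of_int p * x) / (of_int p * (2 * pi)))"
    have "(\<integral>x. indicator {0..2 * pi} x *\<^sub>R (cis (of_int p * x) / (2 * pi)) \<partial>lborel) = G (2 * pi) - G 0"
    proof (rule integral_FTC_atLeastAtMost)
      show "(G has_vector_derivative cis (of_int p * x) / (2 * pi)) (at x within {0..2 * pi})" for x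
      proof -
        have "((\<lambda>z. - \<i> * exp (\<i> * (of_int p * z)) / (of_int p * (2 * pi)))
            has_field_derivative exp (\<i> * (of_int p * of_real x)) / (2 * pi)) (at (of_real x))"
          using False by (auto intro!: derivative_eq_intros simp: field_simps)
        from has_vector_derivative_real_field[OF this] show ?thesis
          by (simp add: G_def cis_conv_exp)
      qed
      show "continuous_on {0..2 * pi} (\<lambda>x. cis (of_int p * x) / (2 * pi))"
        by (intro continuous_intros) auto
    qed simp
    also have "\<dots> = 0"
    proof -
      have "cis (of_int p * (2 * pi)) = 1"
        using cis_multiple_2pi[of "of_int p"] by (simp add: mult.commute mult.left_commute)
      then show ?thesis by (simp add: G_def)
    qed
    finally show ?thesis using False * by simp
  qed
qed

abbreviation torus_measure :: "(real \<times> real) measure" where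
  "torus_measure \<equiv> circle_measure \<Otimes>\<^sub>M circle_measure"

interpretation circle: finite_measure circle_measure
  by (rule finite_measure_circle_measure)

interpretation torus: pair_sigma_finite circle_measure circle_measure ..

lemma finite_measure_torus_measure: "finite_measure torus_measure"
  by (intro finite_measureI)
     (simp add: space_pair_measure circle.emeasure_pair_measure_Times ennreal_mult_eq_top_iff
       flip: UNIV_Times_UNIV)

definition torus_char :: "int \<Rightarrow> int \<Rightarrow> real \<times> real \<Rightarrow> complex" where
  "torus_char p q x = cis (of_int p * fst x) * cis (of_int q * snd x)"

lemma torus_char_mult: "torus_char p q x * torus_char p' q' x = torus_char (p + p') (q + q') x"
  by (simp add: torus_char_def cis_mult algebra_simps)

lemma torus_char_measurable [measurable]: "torus_char p q \<in> borel_measurable torus_measure"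
proof -
  have "(\<lambda>x. torus_char p q x) \<in> borel_measurable torus_measure"
    unfolding torus_char_def by measurable
  then show ?thesis by simp
qed

lemma integrable_torus_char: "integrable torus_measure (torus_char p q)"
  by (rule finite_measure.integrable_const_bound[OF finite_measure_torus_measure, where B = 1])
     (auto simp: torus_char_def norm_mult)

lemma integral_torus_char:
  "(\<integral>x. torus_char p q x \<partial>torus_measure) = (if p = 0 \<and> q = 0 then 1 else 0)"
  by (subst torus.integral_fst'[OF integrable_torus_char, symmetric])
     (simp add: torus_char_def integral_cis_circle_measure)

text \<open>The lower index is an integer and the value is zero outside the row, so that index
  shifts in sums need no truncation.\<close>

definition ibinom :: "nat \<Rightarrow> int \<Rightarrow> real" where
  "ibinom n k = (if k < 0 then 0 else real (n choose nat k))"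

lemma ibinom_eq_0: "k < 0 \<or> int n < k \<Longrightarrow> ibinom n k = 0"
  by (auto simp: ibinom_def)

lemma one_plus_cis_power: "(1 + cis t) ^ n = (\<Sum>k\<in>{0..int n}. ibinom n k * cis (of_int k * t))"
proof -
  have "(1 + cis t) ^ n = (\<Sum>k\<le>n. of_nat (n choose k) * cis t ^ k)"
    using binomial_ring[of "cis t" 1 n] by (simp add: add.commute)
  also have "\<dots> = (\<Sum>k\<in>{0..int n}. ibinom n k * cis (of_int k * t))"
    by (rule sum.reindex_bij_witness[of _ nat int]) (auto simp: ibinom_def Complex.DeMoivre)
  finally show ?thesis .
qed

section \<open>Weyl integration for \<open>SU(3)\<close> in torus coordinates\<close>

text \<open>
  With \<open>z\<^sub>1 = cis \<theta>\<close>, \<open>z\<^sub>2 = cis \<phi>\<close> and \<open>z\<^sub>1 z\<^sub>2 z\<^sub>3 = 1\<close>, \<open>weyl_char\<close> is the product of the \<open>1 + z\<^sub>i\<close>, which is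
  real, and \<open>weyl_density\<close> is a sixth of the product of the \<open>\<bar>z\<^sub>i - z\<^sub>j\<bar>\<^sup>2\<close> over \<open>i < j\<close>.
\<close>

definition weyl_char :: "real \<times> real \<Rightarrow> real" where
  "weyl_char x = 2 + 2 * cos (fst x) + 2 * cos (snd x) + 2 * cos (fst x + snd x)"

definition weyl_density :: "real \<times> real \<Rightarrow> real" where
  "weyl_density x = (2 - 2 * cos (fst x - snd x)) * (2 - 2 * cos (fst x + 2 * snd x))
     * (2 - 2 * cos (2 * fst x + snd x)) / 6"

lemma of_real_2cos: "complex_of_real (2 * cos t) = cis t + cis (- t)"
  by (simp add: complex_eq_iff)

lemma cis_cancel: "cis t * cis (- t) = 1"
  by (simp add: cis_mult)

text \<open>In this form a power splits into three binomial expansions, one for each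
  eigenvalue.\<close>

lemma weyl_char_factor:
  "complex_of_real (weyl_char x) = (1 + cis (fst x)) * (1 + cis (snd x)) * (1 + cis (- (fst x + snd x)))"
proof -
  obtain s t where x: "x = (s, t)" by force
  have "complex_of_real (weyl_char x) = 2 + of_real (2 * cos s) + of_real (2 * cos t) + of_real (2 * cos (s + t))"
    by (simp add: weyl_char_def x)
  also have "\<dots> = 2 + (cis s + cis (- s)) + (cis t + cis (- t)) + (cis s * cis t + cis (- s) * cis (- t))"
    unfolding of_real_2cos by (simp add: cis_mult)
  also have "\<dots> = (1 + cis s) * (1 + cis t) * (1 + cis (- s) * cis (- t))"
    using cis_cancel[of s] cis_cancel[of t] by algebra
  finally show ?thesis by (simp add: x cis_mult)
qed

lemma weyl_density_expand:
  "complex_of_real (weyl_density x) =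
     (6 - 2 * (torus_char 1 (-1) x + torus_char (-1) 1 x + torus_char 1 2 x + torus_char (-1) (-2) x
        + torus_char 2 1 x + torus_char (-2) (-1) x)
      + 2 * (torus_char 3 0 x + torus_char (-3) 0 x + torus_char 3 3 x + torus_char (-3) (-3) x
        + torus_char 0 3 x + torus_char 0 (-3) x)
      - (torus_char 2 (-2) x + torus_char (-2) 2 x + torus_char 2 4 x + torus_char (-2) (-4) x
        + torus_char 4 2 x + torus_char (-4) (-2) x)) / 6"
proof -
  obtain s t where x: "x = (s, t)" by force
  \<comment> \<open>\<open>a\<close> and \<open>b\<close> are the simple roots
    \<open>z\<^sub>1 / z\<^sub>2\<close> and \<open>z\<^sub>2 / z\<^sub>3\<close>, the third
    positive root is \<open>a * b\<close>, and primes denote inverses.\<close>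
  define a a' b b' where "a = torus_char 1 (-1) x" "a' = torus_char (-1) 1 x"
    "b = torus_char 1 2 x" "b' = torus_char (-1) (-2) x"
  note ab = a_a'_b_b'_def
  have c: "a * a' = 1" "b * b' = 1"
    unfolding ab torus_char_mult by (simp_all add: torus_char_def)
  have "complex_of_real (weyl_density x) = (2 - of_real (2 * cos (s - t))) * (2 - of_real (2 * cos (s + 2 * t)))
     * (2 - of_real (2 * cos (2 * s + t))) / 6"
    by (simp add: weyl_density_def x)
  also have "\<dots> = (2 - (a + a')) * (2 - (b + b')) * (2 - (a * b + a' * b')) / 6"
    unfolding of_real_2cos ab torus_char_mult by (simp add: torus_char_def x cis_mult)
  also have "(2 - (a + a')) * (2 - (b + b')) * (2 - (a * b + a' * b'))
      = 6 - 2 * (a + a' + b + b' + a * b + a' * b')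
        + 2 * (a * (a * b) + a' * (a' * b') + b * (a * b) + b' * (a' * b') + a' * b + a * b')
        - (a * a + a' * a' + b * b + b' * b' + (a * b) * (a * b) + (a' * b') * (a' * b'))"
    using c by algebra
  finally show ?thesis
    unfolding ab torus_char_mult by simp
qed

lemma mult_sum_product3:
  fixes t :: "'a :: comm_semiring_0"
  shows "t * (sum f A * sum g B * sum h C) = (\<Sum>a\<in>A. \<Sum>b\<in>B. \<Sum>c\<in>C. t * (f a * g b * h c))"
proof -
  have "sum f A * (sum g B * sum h C) = (\<Sum>a\<in>A. \<Sum>b\<in>B. \<Sum>c\<in>C. f a * (g b * h c))"
    by (subst sum_distrib_right, subst sum_product, simp only: sum_distrib_left)
  then have "t * (sum f A * sum g B * sum h C) = t * (\<Sum>a\<in>A. \<Sum>b\<in>B. \<Sum>c\<in>C. f a * (g b * h c))"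
    by (metis mult.assoc)
  then show ?thesis by (simp only: mult.assoc sum_distrib_left)
qed

text \<open>Orthogonality keeps only the terms with \<open>a = c - p\<close> and
  \<open>b = c - q\<close> of the triple binomial expansion. The shift \<open>m = c + l\<close>
  makes the result symmetric in \<open>i\<close>, \<open>j\<close>, \<open>l\<close>, and the bound
  on \<open>l\<close> allows one summation range for all triples.\<close>

lemma integral_torus_char_weyl_char_power:
  assumes "p = i - l" "q = j - l" "l \<in> {-2..2}"
  shows "(\<integral>x. torus_char p q x * complex_of_real (weyl_char x) ^ n \<partial>torus_measure)
       = of_real (\<Sum>m\<in>{-2..int n + 2}. ibinom n (m - i) * ibinom n (m - j) * ibinom n (m - l))"
proof -
  have "torus_char p q x * complex_of_real (weyl_char x) ^ n
      = (\<Sum>a\<in>{0..int n}. \<Sum>b\<in>{0..int n}. \<Sum>c\<in>{0..int n}.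
          of_real (ibinom n a * ibinom n b * ibinom n c) * torus_char (p + a - c) (q + b - c) x)" for x
  proof -
    have "torus_char p q x * (ibinom n a * cis (of_int a * fst x) * (ibinom n b * cis (of_int b * snd x))
        * (ibinom n c * cis (of_int c * - (fst x + snd x))))
      = of_real (ibinom n a * ibinom n b * ibinom n c) * torus_char (p + a - c) (q + b - c) x" for a b c
    proof -
      have "torus_char (p + a - c) (q + b - c) x = torus_char p q x * cis (of_int a * fst x)
              * cis (of_int b * snd x) * cis (of_int c * - (fst x + snd x))"
        by (simp add: torus_char_def cis_mult algebra_simps)
      then show ?thesis by simp
    qed
    then show ?thesis
      unfolding weyl_char_factor power_mult_distrib one_plus_cis_power mult_sum_product3
      by (intro sum.cong refl)
  qed
  then have "(\<integral>x. torus_char p q x * complex_of_real (weyl_char x) ^ n \<partial>torus_measure)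
      = (\<Sum>a\<in>{0..int n}. \<Sum>b\<in>{0..int n}. \<Sum>c\<in>{0..int n}.
          of_real (ibinom n a * ibinom n b * ibinom n c) * (if p + a - c = 0 \<and> q + b - c = 0 then 1 else 0))"
    by (simp add: integrable_torus_char integral_torus_char)
  also have "\<dots> = of_real (\<Sum>a\<in>{0..int n}. \<Sum>b\<in>{0..int n}. \<Sum>c\<in>{0..int n}.
          if a = c - p \<and> b = c - q then ibinom n a * ibinom n b * ibinom n c else 0)"
    unfolding of_real_sum by (intro sum.cong refl) auto
  also have "(\<Sum>a\<in>{0..int n}. \<Sum>b\<in>{0..int n}. \<Sum>c\<in>{0..int n}.
          if a = c - p \<and> b = c - q then ibinom n a * ibinom n b * ibinom n c else 0)
      = (\<Sum>c\<in>{0..int n}. \<Sum>a\<in>{0..int n}. \<Sum>b\<in>{0..int n}.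
          if a = c - p \<and> b = c - q then ibinom n a * ibinom n b * ibinom n c else 0)"
    by (subst (2) sum.swap, subst sum.swap) (rule refl)
  also have "\<dots> = (\<Sum>c\<in>{0..int n}. ibinom n (c - p) * ibinom n (c - q) * ibinom n c)"
  proof (rule sum.cong[OF refl])
    fix c
    have "(\<Sum>a\<in>{0..int n}. \<Sum>b\<in>{0..int n}.
          if a = c - p \<and> b = c - q then ibinom n a * ibinom n b * ibinom n c else 0)
       = (\<Sum>a\<in>{0..int n}. if a = c - p then \<Sum>b\<in>{0..int n}.
          if b = c - q then ibinom n a * ibinom n b * ibinom n c else 0 else 0)"
      by (intro sum.cong refl) auto
    \<comment> \<open>If \<open>c - p\<close> or \<open>c - q\<close> leaves the range, nothing is
      selected on the left and a factor \<open>ibinom\<close> vanishes on the right.\<close>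
    also have "\<dots> = ibinom n (c - p) * ibinom n (c - q) * ibinom n c"
      by (auto simp: sum.delta ibinom_eq_0)
    finally show "(\<Sum>a\<in>{0..int n}. \<Sum>b\<in>{0..int n}.
          if a = c - p \<and> b = c - q then ibinom n a * ibinom n b * ibinom n c else 0)
       = ibinom n (c - p) * ibinom n (c - q) * ibinom n c" .
  qed
  also have "\<dots> = (\<Sum>m\<in>{l..int n + l}. ibinom n (m - i) * ibinom n (m - j) * ibinom n (m - l))"
    by (rule sum.reindex_bij_witness[of _ "\<lambda>m. m - l" "\<lambda>c. c + l"]) (auto simp: assms algebra_simps)
  also have "\<dots> = (\<Sum>m\<in>{-2..int n + 2}. ibinom n (m - i) * ibinom n (m - j) * ibinom n (m - l))"
    by (rule sum.mono_neutral_left) (use assms in \<open>auto simp: ibinom_eq_0\<close>)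
  finally show ?thesis .
qed

lemma weyl_density_nonneg: "0 \<le> weyl_density x"
  unfolding weyl_density_def by (intro divide_nonneg_nonneg mult_nonneg_nonneg) auto

text \<open>Three factors of at most 4 give \<open>64 / 6\<close>, which is below 11.\<close>

lemma weyl_density_le: "weyl_density x \<le> 11"
proof -
  have "\<bar>2 - 2 * cos t\<bar> \<le> 4" for t :: real
    using cos_ge_minus_one[of t] cos_le_one[of t] by linarith
  then have "\<bar>2 - 2 * cos (fst x - snd x)\<bar> * \<bar>2 - 2 * cos (fst x + 2 * snd x)\<bar>
     * \<bar>2 - 2 * cos (2 * fst x + snd x)\<bar> \<le> 4 * 4 * 4"
    by (intro mult_mono) auto
  then show ?thesis
    unfolding weyl_density_def abs_mult[symmetric] by simp
qed

lemma weyl_char_bounds: "- 1 \<le> weyl_char x" "weyl_char x \<le> 8"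
proof -
  obtain s t where x: "x = (s, t)" by force
  \<comment> \<open>The right-hand side is the squared modulus of
    \<open>1 + cis s + cis (- t)\<close>.\<close>
  have "weyl_char x + 1 = (1 + cos s + cos t)\<^sup>2 + (sin s - sin t)\<^sup>2"
    by (simp add: weyl_char_def x cos_add power2_sum power2_diff cos_squared_eq algebra_simps)
  then show "- 1 \<le> weyl_char x"
    by (smt (verit) zero_le_power2)
  show "weyl_char x \<le> 8"
    using cos_le_one[of s] cos_le_one[of t] cos_le_one[of "s + t"]
    unfolding weyl_char_def x fst_conv snd_conv by linarith
qed

lemma integrable_torus_char_weyl_char_power:
  "integrable torus_measure (\<lambda>x. torus_char p q x * complex_of_real (weyl_char x) ^ n)"
proof (rule finite_measure.integrable_const_bound[OF finite_measure_torus_measure, where B = "8 ^ n"])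
  have "\<bar>weyl_char x\<bar> \<le> 8" for x
    using weyl_char_bounds[of x] by linarith
  then show "AE x in torus_measure. norm (torus_char p q x * complex_of_real (weyl_char x) ^ n) \<le> 8 ^ n"
    by (intro AE_I2) (simp add: norm_mult norm_power torus_char_def power_mono)
qed (simp add: weyl_char_def)

section \<open>Baxter numbers as determinant sums and as torus integrals\<close>

text \<open>
  The left-hand side is the determinant of the \<open>3 \<times> 3\<close> matrix with entries \<open>ibinom n (k + j - i)\<close>.
\<close>

lemma ibinom_det:
  assumes "k \<in> {0..int n}"
  shows "ibinom n k ^ 3 - 2 * (ibinom n k * ibinom n (k + 1) * ibinom n (k - 1))
      + (ibinom n (k + 1))\<^sup>2 * ibinom n (k - 2) + ibinom n (k + 2) * (ibinom n (k - 1))\<^sup>2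
      - ibinom n (k + 2) * ibinom n (k - 2) * ibinom n k
    = 2 / (real (n + 1) * (real (n + 2))\<^sup>2)
      * (ibinom (n + 2) k * ibinom (n + 2) (k + 1) * ibinom (n + 2) (k + 2))"
proof -
  \<comment> \<open>In terms of \<open>x = k\<close> and \<open>y = n - k\<close> every entry is
    \<open>c\<close> times a rational function, so the claim becomes an identity of rational
    functions.\<close>
  define c where "c = ibinom n k"
  define x where "x = real_of_int k"
  define y where "y = real n - x"
  \<comment> \<open>The product form holds for every integer \<open>j\<close>: outside the row both
    sides vanish, at \<open>j = - 1\<close> because of the factor \<open>j + 1\<close>.\<close>
  have up: "ibinom n (j + 1) * (of_int j + 1) = ibinom n j * (real n - of_int j)" for n j
  proof (cases "0 \<le> j \<and> j \<le> int n")
    case True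
    then obtain i where i: "j = int i" "i \<le> n" by (metis nonneg_int_cases of_nat_le_iff)
    have "(n choose Suc i) * Suc i = (n choose i) * (n - i)"
      using binomial_absorb_comp[of n i] binomial_absorption[of i n]
      by (metis Suc_times_binomial_eq binomial_absorb_comp mult.commute times_binomial_minus1_eq)
    then have "real (n choose Suc i) * real (Suc i) = real (n choose i) * real (n - i)"
      by (metis of_nat_mult)
    then show ?thesis using i by (simp add: ibinom_def nat_add_distrib of_nat_diff add.commute)
  next
    case False
    then show ?thesis by (cases "j = - 1") (auto simp: ibinom_eq_0)
  qed
  have pascal: "ibinom (n + 1) (j + 1) = ibinom n j + ibinom n (j + 1)" for n j
  proof (cases "0 \<le> j")
    case True
    then show ?thesis by (simp add: ibinom_def nat_add_distrib)
  next
    case False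
    then show ?thesis by (cases "j = - 1") (auto simp: ibinom_def)
  qed
  have xy: "0 \<le> x" "0 \<le> y" "real n = x + y"
    using assms by (auto simp: x_def y_def)
  have p1: "ibinom n (k + 1) = c * y / (x + 1)"
    using up[of n k] xy by (simp add: c_def[symmetric] x_def[symmetric] y_def[symmetric] field_simps)
  have p2: "ibinom n (k + 2) = c * y * (y - 1) / ((x + 1) * (x + 2))"
  proof -
    have "ibinom n (k + 2) * (x + 2) = ibinom n (k + 1) * (y - 1)"
      using up[of n "k + 1"] by (simp add: x_def y_def add_ac diff_diff_eq)
    then have "ibinom n (k + 2) = ibinom n (k + 1) * (y - 1) / (x + 2)"
      using xy by (simp add: eq_divide_eq)
    then show ?thesis by (simp add: p1)
  qed
  have m1: "ibinom n (k - 1) = c * x / (y + 1)"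
    using up[of n "k - 1"] xy by (simp add: c_def[symmetric] x_def[symmetric] y_def[symmetric] field_simps)
  have m2: "ibinom n (k - 2) = c * x * (x - 1) / ((y + 1) * (y + 2))"
  proof -
    have "ibinom n (k - 2) * (y + 2) = ibinom n (k - 1) * (x - 1)"
      using up[of n "k - 2"] by (simp add: x_def y_def algebra_simps)
    then have "ibinom n (k - 2) = ibinom n (k - 1) * (x - 1) / (y + 2)"
      using xy by (simp add: eq_divide_eq)
    then show ?thesis by (simp add: m1)
  qed
  have pascal2: "ibinom (n + 2) (j + 2) = ibinom n j + 2 * ibinom n (j + 1) + ibinom n (j + 2)" for j
    using pascal[of "n + 1" "j + 1"] pascal[of n j] pascal[of n "j + 1"] by (simp add: add_ac)
  have nz: "x + 1 \<noteq> 0" "x + 2 \<noteq> 0" "y + 1 \<noteq> 0" "y + 2 \<noteq> 0" "x + y + 1 \<noteq> 0" "x + y + 2 \<noteq> 0"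
    using xy by auto
  have q0: "ibinom (n + 2) k = c * (x + y + 1) * (x + y + 2) / ((y + 1) * (y + 2))"
  proof -
    have "ibinom (n + 2) k = ibinom n (k - 2) + 2 * ibinom n (k - 1) + ibinom n k"
      using pascal2[of "k - 2"] by (simp add: add.commute)
    also have "\<dots> = c * x * (x - 1) / ((y + 1) * (y + 2)) + 2 * (c * x / (y + 1)) + c"
      by (simp only: m1 m2 p1 p2 c_def)
    also have "\<dots> = c * (x + y + 1) * (x + y + 2) / ((y + 1) * (y + 2))"
      using nz by (simp add: divide_simps) algebra
    finally show ?thesis .
  qed
  have q1: "ibinom (n + 2) (k + 1) = c * (x + y + 1) * (x + y + 2) / ((x + 1) * (y + 1))"
  proof -
    have "ibinom (n + 2) (k + 1) = ibinom n (k - 1) + 2 * ibinom n k + ibinom n (k + 1)"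
      using pascal2[of "k - 1"] by (simp add: add.commute)
    also have "\<dots> = c * x / (y + 1) + 2 * c + c * y / (x + 1)"
      by (simp only: m1 m2 p1 p2 c_def)
    also have "\<dots> = c * (x + y + 1) * (x + y + 2) / ((x + 1) * (y + 1))"
      using nz by (simp add: divide_simps) algebra
    finally show ?thesis .
  qed
  have q2: "ibinom (n + 2) (k + 2) = c * (x + y + 1) * (x + y + 2) / ((x + 1) * (x + 2))"
  proof -
    have "ibinom (n + 2) (k + 2) = ibinom n k + 2 * ibinom n (k + 1) + ibinom n (k + 2)"
      using pascal2[of "k"] by (simp add: add.commute)
    also have "\<dots> = c + 2 * (c * y / (x + 1)) + c * y * (y - 1) / ((x + 1) * (x + 2))"
      by (simp only: m1 m2 p1 p2 c_def)
    also have "\<dots> = c * (x + y + 1) * (x + y + 2) / ((x + 1) * (x + 2))"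
      using nz by (simp add: divide_simps) algebra
    finally show ?thesis .
  qed
  have n: "real (n + 1) = x + y + 1" "real (n + 2) = x + y + 2" using xy by auto
  show ?thesis
    unfolding q0 q1 q2 p1 p2 m1 m2 n c_def[symmetric] using nz
    by (simp add: divide_simps) algebra
qed

text \<open>\<open>ibinom_det\<close> is summed, with an index one below that of
  \<open>baxter\<close>. The range is widened by vanishing terms to match
  \<open>integral_torus_char_weyl_char_power\<close>.\<close>

lemma baxter_eq_ibinom_sum:
  "baxter (Suc n) = (\<Sum>k\<in>{-2..int n + 2}. ibinom n k ^ 3 - 2 * (ibinom n k * ibinom n (k + 1) * ibinom n (k - 1))
      + (ibinom n (k + 1))\<^sup>2 * ibinom n (k - 2) + ibinom n (k + 2) * (ibinom n (k - 1))\<^sup>2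
      - ibinom n (k + 2) * ibinom n (k - 2) * ibinom n k)" (is "_ = sum ?D _")
proof -
  have "sum ?D {-2..int n + 2} = sum ?D {0..int n}"
    by (rule sum.mono_neutral_right) (auto simp: ibinom_eq_0 power2_eq_square)
  also have "\<dots> = (\<Sum>k\<in>{0..int n}. 2 / (real (n + 1) * (real (n + 2))\<^sup>2)
      * (ibinom (n + 2) k * ibinom (n + 2) (k + 1) * ibinom (n + 2) (k + 2)))"
    by (intro sum.cong refl ibinom_det)
  also have "\<dots> = baxter (Suc n)"
    unfolding baxter_def
    by (rule sum.reindex_bij_witness[of _ "\<lambda>k. int k - 1" "\<lambda>k. nat (k + 1)"])
       (auto simp: ibinom_def nat_add_distrib nat_diff_distrib add_ac of_nat_diff numeral_2_eq_2 numeral_3_eq_3)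
  finally show ?thesis by simp
qed

text \<open>Each character of the density contributes a sum \<open>S i j l\<close> that is symmetric
  in its arguments. Terms that differ by a permutation coincide, which cancels the denominator 6 and
  leaves the five terms of the determinant.\<close>

lemma baxter_eq_integral:
  "baxter (Suc n) = (\<integral>x. weyl_char x ^ n * weyl_density x \<partial>torus_measure)"
proof -
  define J where "J = (\<lambda>p q. \<integral>x. torus_char p q x * complex_of_real (weyl_char x) ^ n \<partial>torus_measure)"
  define S where "S = (\<lambda>i j l. \<Sum>m\<in>{-2..int n + 2}. ibinom n (m - i) * ibinom n (m - j) * ibinom n (m - l))"
  note I = integrable_torus_char_weyl_char_power
  have J: "J (i - l) (j - l) = of_real (S i j l)" if "l \<in> {-2..2}" for i j l
    unfolding J_def S_def by (rule integral_torus_char_weyl_char_power) (use that in auto)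
  have one: "torus_char 0 0 x = 1" for x by (simp add: torus_char_def)
  (* All exponents of the density have p + q divisible by 3; take l = - (p + q) div 3. *)
  have "complex_of_real (\<integral>x. weyl_char x ^ n * weyl_density x \<partial>torus_measure)
      = (\<integral>x. complex_of_real (weyl_density x) * complex_of_real (weyl_char x) ^ n \<partial>torus_measure)"
    by (simp flip: integral_complex_of_real add: mult.commute)
  also have "\<dots> = (6 * J 0 0 - 2 * (J 1 (-1) + J (-1) 1 + J 1 2 + J (-1) (-2) + J 2 1 + J (-2) (-1))
      + 2 * (J 3 0 + J (-3) 0 + J 3 3 + J (-3) (-3) + J 0 3 + J 0 (-3))
      - (J 2 (-2) + J (-2) 2 + J 2 4 + J (-2) (-4) + J 4 2 + J (-4) (-2))) / 6"
    using I[of 0 0] unfolding weyl_density_expand J_def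
    by (simp add: ring_distribs add_divide_distrib diff_divide_distrib one I)
  also have "\<dots> = of_real (S 0 0 0 - 2 * S 0 (-1) 1 + S (-1) (-1) 2 + S (-2) 1 1 - S (-2) 2 0)"
  proof -
    have sym: "S i j l = S j i l" "S i j l = S i l j" for i j l
      unfolding S_def by (simp_all add: mult_ac)
    have "J 0 0 = of_real (S 0 0 0)"
      "J 1 (-1) = of_real (S 1 (-1) 0)" "J (-1) 1 = of_real (S (-1) 1 0)"
      "J 1 2 = of_real (S 0 1 (-1))" "J (-1) (-2) = of_real (S 0 (-1) 1)"
      "J 2 1 = of_real (S 1 0 (-1))" "J (-2) (-1) = of_real (S (-1) 0 1)"
      "J 3 0 = of_real (S 2 (-1) (-1))" "J (-3) 0 = of_real (S (-2) 1 1)"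
      "J 3 3 = of_real (S 1 1 (-2))" "J (-3) (-3) = of_real (S (-1) (-1) 2)"
      "J 0 3 = of_real (S (-1) 2 (-1))" "J 0 (-3) = of_real (S 1 (-2) 1)"
      "J 2 (-2) = of_real (S 2 (-2) 0)" "J (-2) 2 = of_real (S (-2) 2 0)"
      "J 2 4 = of_real (S 0 2 (-2))" "J (-2) (-4) = of_real (S 0 (-2) 2)"
      "J 4 2 = of_real (S 2 0 (-2))" "J (-4) (-2) = of_real (S (-2) 0 2)"
      using J[of 0 0 0] J[of 0 1 "-1"] J[of 0 "-1" 1] J[of "-1" 1 0] J[of 1 "-1" 0]
        J[of "-1" 1 0] J[of "-1" 0 1] J[of 1 0 "-1"] J[of "-1" 2 "-1"] J[of 1 "-2" 1]
        J[of "-2" 1 1] J[of 2 "-1" "-1"] J[of "-1" "-1" 2] J[of 1 1 "-2"]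
        J[of 0 2 "-2"] J[of 0 "-2" 2] J[of 0 "-2" 2] J[of 2 "-2" 0] J[of 2 0 "-2"] J[of "-2" 2 0] J[of "-2" 0 2]
      by simp_all
    then show ?thesis
      by (simp add: sym)
  qed
  also have "S 0 0 0 - 2 * S 0 (-1) 1 + S (-1) (-1) 2 + S (-2) 1 1 - S (-2) 2 0 = baxter (Suc n)"
    unfolding baxter_eq_ibinom_sum S_def
    by (simp add: sum.distrib sum_subtractf sum_distrib_left power2_eq_square power3_eq_cube mult_ac)
  finally show ?thesis by (simp only: of_real_eq_iff)
qed

subsection \<open>Baxter numbers as moments\<close>

lemma moment_sequence_baxter: "moment_sequence 1 8 (\<lambda>n. baxter (Suc n))"
proof (rule moment_sequence_pushforward[where P = torus_measure and f = weyl_char and w = weyl_density and C = 11])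
  show "finite_measure torus_measure" by (rule finite_measure_torus_measure)
  show "weyl_char \<in> borel_measurable torus_measure"
    unfolding weyl_char_def[abs_def] by measurable
  show "weyl_density \<in> borel_measurable torus_measure"
    unfolding weyl_density_def[abs_def] by measurable
  show "AE x in torus_measure. - 1 \<le> weyl_char x \<and> weyl_char x \<le> 8"
    by (simp add: weyl_char_bounds)
  show "0 \<le> weyl_density x" for x by (rule weyl_density_nonneg)
  show "AE x in torus_measure. weyl_density x \<le> 11" by (simp add: weyl_density_le)
  show "baxter (Suc n) = (\<integral>x. weyl_char x ^ n * weyl_density x \<partial>torus_measure)" for n
    by (rule baxter_eq_integral)
  show "\<exists>A\<in>sets torus_measure. 0 < emeasure torus_measure A
      \<and> (\<forall>x\<in>A. t < weyl_char x \<and> weyl_char x < 8 \<and> 0 < weyl_density x)" if "t < 8" for t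
  proof -
    \<comment> \<open>From \<open>1 - u * u / 2 \<le> cos u\<close> the defect
      \<open>8 - weyl_char p\<close> is below \<open>6 * (d * d)\<close>, which is at most
      \<open>3 * d\<close> as \<open>d \<le> 1 / 2\<close>, hence below
      \<open>8 - t\<close>.\<close>
    define d where "d = min (1 / 2) ((8 - t) / 6)"
    have d: "0 < d" "d \<le> 1 / 2" "6 * d \<le> 8 - t" using that by (auto simp: d_def min_def)
    have pi: "3 < pi" by (rule pi_gt3)
    \<comment> \<open>\<open>weyl_char\<close> reaches 8 at the origin, where the density vanishes.
      The rectangle lies beside it with \<open>0 < y < x\<close>, so all angles that occur are
      strictly between 0 and 3.\<close>
    let ?A = "{d / 2<..<d} \<times> {0<..<d / 2}"
    show ?thesis
    proof (intro bexI[of _ ?A] conjI ballI)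
      show "?A \<in> sets torus_measure" by simp
      show "0 < emeasure torus_measure ?A"
        using d pi by (simp add: circle.emeasure_pair_measure_Times ennreal_zero_less_mult_iff emeasure_circle_measure_pos)
    next
      fix p assume "p \<in> ?A"
      then obtain x y where p: "p = (x, y)" "d / 2 < x" "x < d" "0 < y" "y < d / 2" by auto
      have lt1: "cos u < 1" if "0 < u" "u < 3" for u :: real
        using cos_monotone_0_pi[of 0 u] that pi by simp
      have ge: "1 - u * u / 2 \<le> cos u" for u :: real
      proof -
        have "(sin (u / 2))\<^sup>2 \<le> (u / 2)\<^sup>2"
          using abs_sin_x_le_abs_x[of "u / 2"] by (simp only: abs_le_square_iff)
        then show ?thesis
          using cos_double_sin[of "u / 2"] by (simp add: power2_eq_square)
      qed
      show "weyl_char p < 8"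
        using lt1[of x] lt1[of y] lt1[of "x + y"] p d by (simp add: weyl_char_def)
      have "0 < 2 - 2 * cos (x - y)" "0 < 2 - 2 * cos (x + 2 * y)" "0 < 2 - 2 * cos (2 * x + y)"
        using lt1[of "x - y"] lt1[of "x + 2 * y"] lt1[of "2 * x + y"] p d by auto
      then show "0 < weyl_density p" by (simp add: weyl_density_def p)
      have "x * x < d * d" "y * y < d * d" "(x + y) * (x + y) < (2 * d) * (2 * d)"
        by (rule mult_strict_mono'; use p d in simp)+
      moreover have "d * d \<le> d * (1 / 2)" using d by (intro mult_left_mono) auto
      moreover have "(2 * d) * (2 * d) = 4 * (d * d)" by simp
      ultimately show "t < weyl_char p"
        using ge[of x] ge[of y] ge[of "x + y"] d
        unfolding weyl_char_def p(1) fst_conv snd_conv by linarith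
    qed
  qed
qed

section \<open>The index shift, small values and the conclusion\<close>

lemma funpow_log_op_Suc: "(log_op ^^ j) (\<lambda>n. a (Suc n)) n = (log_op ^^ j) a (Suc n)"
  by (induction j arbitrary: n) (simp_all add: log_op_def)

text \<open>The largest index needed is 12: the second iterate of the shifted sequence at index 7
  involves \<open>baxter 8\<close> to \<open>baxter 12\<close>.\<close>

lemma baxter_values:
  "baxter (Suc 0) = 1"
  "baxter 2 = 2"
  "baxter 3 = 6"
  "baxter 4 = 22"
  "baxter 5 = 92"
  "baxter 6 = 422"
  "baxter 7 = 2074"
  "baxter 8 = 10754"
  "baxter 9 = 58202"
  "baxter 10 = 326240"
  "baxter 11 = 1882960"
  "baxter 12 = 11140560"
  by (simp_all add: baxter_def sum.atLeast_Suc_atMost binomial_fact eval_nat_numeral)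

theorem theorem1p3:
  shows "(\<forall>r\<ge>1. asymptotically_r_log_convex r baxter) \<and> r_log_convex_from 1 2 baxter"
proof
  let ?b = "\<lambda>n. baxter (Suc n)"
  have "\<forall>\<^sub>F n in sequentially. 0 \<le> (log_op ^^ j) baxter n" for j
  proof -
    obtain m M where "0 \<le> m" "m < M" "moment_sequence m M ((log_op ^^ j) ?b)"
      using moment_sequence_log_op_funpow[OF moment_sequence_baxter, of j] by auto
    then have "\<forall>\<^sub>F n in sequentially. 0 \<le> (log_op ^^ j) ?b n"
      by (intro moment_sequence_eventually_nonneg)
    then show ?thesis
      by (simp only: funpow_log_op_Suc
            eventually_sequentially_Suc[where P = "\<lambda>n. 0 \<le> (log_op ^^ j) baxter n"])
  qed
  then show "\<forall>r\<ge>1. asymptotically_r_log_convex r baxter"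
    by (simp add: asymptotically_r_log_convex_def)
  have L1: "moment_sequence 8 64 (log_op ?b)"
    using moment_sequence_log_op[OF moment_sequence_baxter] by simp
  have L2: "moment_sequence 512 4096 (log_op (log_op ?b))"
    using moment_sequence_log_op[OF L1] by simp
  have nonneg1: "0 \<le> log_op ?b n" for n
  proof (cases "2 \<le> n")
    \<comment> \<open>The starting inequality with \<open>l = 8\<close> fails at index 0, where the
      terms are 2 and 8; at index 2 they are 68 and 820.\<close>
    case True
    then show ?thesis
      by (intro moment_sequence_nonneg_from[OF L1, of 8 2]) (simp_all add: log_op_def baxter_values)
  next
    case False
    then consider "even n" | "n = 1" by (cases n) (auto simp: less_2_cases_iff not_le)
    then show ?thesis
    proof cases
      case 1
      then show ?thesis by (rule moment_sequence_even_nonneg[OF L1])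
    qed (simp_all add: log_op_def baxter_values baxter_values[unfolded numeral_nat])
  qed
  have nonneg2: "0 \<le> log_op (log_op ?b) n" for n
  proof (cases "6 \<le> n")
    \<comment> \<open>With \<open>l = 512\<close> the starting inequality fails at the even indices
      0, 2 and 4, so 6 is the first possible start; the odd indices below it are computed.\<close>
    case True
    then show ?thesis
      by (intro moment_sequence_nonneg_from[OF L2, of 512 6]) (simp_all add: log_op_def baxter_values)
  next
    case False
    then have "n \<in> {0, 1, 2, 3, 4, 5}" by auto
    then consider "even n" | "n = 1" | "n = 3" | "n = 5" by auto
    then show ?thesis
    proof cases
      case 1
      then show ?thesis by (rule moment_sequence_even_nonneg[OF L2])
    qed (simp_all add: log_op_def baxter_values baxter_values[unfolded numeral_nat])
  qed
  have "0 \<le> (log_op ^^ j) ?b n" if "1 \<le> j" "j \<le> 2" for j n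
  proof -
    from that consider "j = 1" | "j = 2" by linarith
    then show ?thesis using nonneg1 nonneg2
      by cases (simp_all add: numeral_2_eq_2)
  qed
  then have "0 \<le> (log_op ^^ j) baxter n" if "1 \<le> j" "j \<le> 2" "1 \<le> n" for j n
    using that by (cases n) (auto simp: funpow_log_op_Suc)
  then show "r_log_convex_from 1 2 baxter"
    by (simp add: r_log_convex_from_def)
qed

end
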